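(* Let $\alpha_n$ be the chromatic number of the $n$-dimensional associahedron (with respect to proper colourings of its facets). When $n$ tends to infinity, $\alpha_n\sim n\ln n$, i.e. $\lim_{n\to+\infty}\frac{\alpha_n}{n\ln n}=1$.
   Context: For $n\geq 1$ let $[n]=\{1,\ldots,n\}$ and $[n]_0=\{0,1,\ldots,n\}$. A building set is a collection $\mathcal{B}$ of nonempty subsets of $[n]_0$ containing all singletons $\{x\}$, $x\in[n]_0$, such that $S_1,S_2\in\mathcal{B}$ and $S_1\cap S_2\neq\emptyset$ imply $S_1\cup S_2\in\mathcal{B}$. For a family of sets $N$, an $N$-antichain is a subset $\{X_1,\ldots,X_m\}\subseteq N$ with $m\geq 2$ whose members are mutually incomparable with respect to $\subseteq$. Assuming $[n]_0\in\mathcal{B}$, a set $N\subseteq\mathcal{B}$ is nested when the union of every $N$-antichain is not an element of $\mathcal{B}$. The nested-set complex of $\mathcal{B}$ is the simplicial complex of all nested sets $N$ with $[n]_0\notin N$. It is realised by a simple $n$-dimensional polytope (the nestohedron of $\mathcal{B}$): its face lattice with the bottom (the empty face) removed is isomorphic to the complex ordered by $\supseteq$. Hence its facets are identified with the elements $X\in\mathcal{B}$, $X\neq[n]_0$, and two facets have a common vertex iff some nested set contains both. The $n$-dimensional associahedron is the nestohedron of the building set of all nonempty connected subsets of vertices of the path $0-1-\cdots-n$, i.e. of all sets $[a,b]=\{x\in[n]_0\mid a\leq x\leq b\}$ with $0\leq a\leq b\leq n$. Its facets are identified with those $[a,b]$ that are proper subsets of $[n]_0$. Two facets of a polytope are separated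 when they have no vertex in common. For $\mathcal{F}$ the set of facets of a polytope, a function $f\colon\mathcal{F}\to[m]$ is a proper colouring when every two (distinct) facets of the same colour are separated. The chromatic number of the polytope is the minimal $m$ such that a proper colouring of its facets with $m$ colours exists. *)

theory Defs
  imports "HOL-Analysis.Polytope"
begin

section \<open>Chromatic number of a polytope, in terms of its face poset\<close>

text \<open>
  A combinatorial polytope is given by the carrier \<open>L\<close> and the order \<open>le\<close> of its face lattice with
  the empty face removed; the polytope itself is the greatest element of \<open>L\<close>.
\<close>

definition proper_faces :: "'a set \<Rightarrow> ('a \<Rightarrow> 'a \<Rightarrow> bool) \<Rightarrow> 'a set" where
  "proper_faces L le = {F \<in> L. \<exists>G\<in>L. \<not> le G F}"

definition facets :: "'a set \<Rightarrow> ('a \<Rightarrow> 'a \<Rightarrow> bool) \<Rightarrow> 'a set" where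
  "facets L le = {F \<in> proper_faces L le. \<forall>G\<in>proper_faces L le. le F G \<longrightarrow> G = F}"

definition vertices :: "'a set \<Rightarrow> ('a \<Rightarrow> 'a \<Rightarrow> bool) \<Rightarrow> 'a set" where
  "vertices L le = {V \<in> L. \<forall>G\<in>L. le G V \<longrightarrow> G = V}"

definition separated :: "'a set \<Rightarrow> ('a \<Rightarrow> 'a \<Rightarrow> bool) \<Rightarrow> 'a \<Rightarrow> 'a \<Rightarrow> bool" where
  "separated L le F G \<longleftrightarrow> \<not> (\<exists>V\<in>vertices L le. le V F \<and> le V G)"

definition proper_colouring ::
    "'a set \<Rightarrow> ('a \<Rightarrow> 'a \<Rightarrow> bool) \<Rightarrow> nat \<Rightarrow> ('a \<Rightarrow> nat) \<Rightarrow> bool" where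
  "proper_colouring L le m f \<longleftrightarrow>
     (\<forall>F\<in>facets L le. f F \<in> {1..m}) \<and>
     (\<forall>F\<in>facets L le. \<forall>G\<in>facets L le. F \<noteq> G \<and> f F = f G \<longrightarrow> separated L le F G)"

definition chromatic_number :: "'a set \<Rightarrow> ('a \<Rightarrow> 'a \<Rightarrow> bool) \<Rightarrow> nat" where
  "chromatic_number L le = (LEAST m. \<exists>f. proper_colouring L le m f)"


section \<open>Building sets and nested-set complexes\<close>

definition building_set :: "nat \<Rightarrow> nat set set \<Rightarrow> bool" where
  "building_set n B \<longleftrightarrow>
     (\<forall>S\<in>B. S \<noteq> {} \<and> S \<subseteq> {0..n}) \<and>
     (\<forall>x\<in>{0..n}. {x} \<in> B) \<and>
     (\<forall>S1\<in>B. \<forall>S2\<in>B. S1 \<inter> S2 \<noteq> {} \<longrightarrow> S1 \<union> S2 \<in> B)"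

text \<open>The bound on \<^term>\<open>card A\<close> makes antichains finite.\<close>

definition antichain_in :: "'a set set \<Rightarrow> 'a set set \<Rightarrow> bool" where
  "antichain_in N A \<longleftrightarrow>
     A \<subseteq> N \<and> 2 \<le> card A \<and> (\<forall>X\<in>A. \<forall>Y\<in>A. X \<noteq> Y \<longrightarrow> \<not> X \<subseteq> Y)"

definition nested :: "'a set set \<Rightarrow> 'a set set \<Rightarrow> bool" where
  "nested B N \<longleftrightarrow> N \<subseteq> B \<and> (\<forall>A. antichain_in N A \<longrightarrow> \<Union>A \<notin> B)"

text \<open>
  The nonempty faces of the nestohedron are the members of the nested-set complex ordered by
  \<open>\<supseteq>\<close>; in particular the polytope itself is the empty nested set, and its facets are the
  singletons \<open>{X}\<close>.
\<close>

definition nested_set_complex :: "nat \<Rightarrow> nat set set \<Rightarrow> nat set set set" where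
  "nested_set_complex n B = {N. nested B N \<and> {0..n} \<notin> N}"

definition nestohedron_chromatic_number :: "nat \<Rightarrow> nat set set \<Rightarrow> nat" where
  "nestohedron_chromatic_number n B = chromatic_number (nested_set_complex n B) (\<supseteq>)"


section \<open>Associahedra\<close>

text \<open>
  The nonempty sets of vertices of the path \<open>0 - 1 - \<dots> - n\<close> that are connected.
\<close>

definition path_building_set :: "nat \<Rightarrow> nat set set" where
  "path_building_set n = {{a..b} | a b. a \<le> b \<and> b \<le> n}"

definition associahedron_chromatic_number :: "nat \<Rightarrow> nat" where
  "associahedron_chromatic_number n = nestohedron_chromatic_number n (path_building_set n)"

lemma building_set_path: "building_set n (path_building_set n)"
  unfolding building_set_def
proof (intro conjI ballI impI)
  fix S assume "S \<in> path_building_set n"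
  then show "S \<noteq> {}" "S \<subseteq> {0..n}"
    by (auto simp: path_building_set_def)
next
  fix x assume "x \<in> {0..n}"
  then have "{x} = {x..x} \<and> x \<le> x \<and> x \<le> n" by simp
  then show "{x} \<in> path_building_set n"
    unfolding path_building_set_def by blast
next
  fix S1 S2
  assume "S1 \<in> path_building_set n" "S2 \<in> path_building_set n" and ne: "S1 \<inter> S2 \<noteq> {}"
  then obtain a b c d where S: "S1 = {a..b}" "a \<le> b" "b \<le> n" "S2 = {c..d}" "c \<le> d" "d \<le> n"
    by (auto simp: path_building_set_def)
  have "S1 \<union> S2 = {min a c..max b d}"
    using ne S by auto
  moreover have "min a c \<le> max b d" "max b d \<le> n"
    using S by auto
  ultimately show "S1 \<union> S2 \<in> path_building_set n"
    unfolding path_building_set_def by blast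
qed

lemma whole_in_path_building_set: "{0..n} \<in> path_building_set n"
  by (auto simp: path_building_set_def)


section \<open>Agreement with convex polytopes in Euclidean space\<close>

definition face_poset :: "'a::euclidean_space set \<Rightarrow> 'a set set" where
  "face_poset P = {F. F face_of P \<and> F \<noteq> {}}"

lemma facets_face_poset:
  fixes P :: "'a::euclidean_space set"
  assumes P: "polytope P"
  shows "facets (face_poset P) (\<subseteq>) = {F. F facet_of P}"
proof -
  have cv: "convex P" using P by (rule polytope_imp_convex)
  have pf: "proper_faces (face_poset P) (\<subseteq>) = {F. F face_of P \<and> F \<noteq> {} \<and> F \<noteq> P}"
  proof (intro set_eqI iffI)
    fix F assume "F \<in> proper_faces (face_poset P) (\<subseteq>)"
    then show "F \<in> {F. F face_of P \<and> F \<noteq> {} \<and> F \<noteq> P}"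
      by (auto simp: proper_faces_def face_poset_def dest: face_of_imp_subset)
  next
    fix F assume F: "F \<in> {F. F face_of P \<and> F \<noteq> {} \<and> F \<noteq> P}"
    then have sub: "F \<subseteq> P" by (auto dest: face_of_imp_subset)
    with F have "P \<noteq> {}" by auto
    then have "P \<in> face_poset P" using face_of_refl[OF cv] by (simp add: face_poset_def)
    moreover have "\<not> P \<subseteq> F" using F sub by auto
    ultimately show "F \<in> proper_faces (face_poset P) (\<subseteq>)"
      using F by (auto simp: proper_faces_def face_poset_def)
  qed
  show ?thesis
  proof (intro set_eqI iffI)
    fix F assume "F \<in> facets (face_poset P) (\<subseteq>)"
    then have F: "F face_of P" "F \<noteq> {}" "F \<noteq> P"
      and mx: "\<And>G. G face_of P \<Longrightarrow> G \<noteq> {} \<Longrightarrow> G \<noteq> P \<Longrightarrow> F \<subseteq> G \<Longrightarrow> G = F"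
      unfolding facets_def pf by auto
    obtain G where G: "G facet_of P" "F \<subseteq> G"
      using face_of_polyhedron_subset_facet[OF polytope_imp_polyhedron[OF P] F] .
    then have "G face_of P" "G \<noteq> {}" "G \<noteq> P"
      by (auto simp: facet_of_def)
    then have "G = F"
      using mx G(2) by blast
    with G show "F \<in> {F. F facet_of P}" by simp
  next
    fix F assume "F \<in> {F. F facet_of P}"
    then have F: "F face_of P" "F \<noteq> {}" "aff_dim F = aff_dim P - 1"
      by (auto simp: facet_of_def)
    have "G = F" if G: "G face_of P" "G \<noteq> P" "F \<subseteq> G" for G
    proof (rule ccontr)
      assume "G \<noteq> F"
      have "F face_of G" using face_of_subset[OF F(1) G(3) face_of_imp_subset[OF G(1)]] .
      then have "aff_dim F < aff_dim G"
        using face_of_aff_dim_lt[OF face_of_imp_convex[OF G(1)]] \<open>G \<noteq> F\<close> by auto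
      moreover have "aff_dim G < aff_dim P"
        using face_of_aff_dim_lt[OF cv G(1,2)] .
      ultimately show False using F(3) by linarith
    qed
    moreover have "F \<noteq> P" using F(3) by auto
    ultimately show "F \<in> facets (face_poset P) (\<subseteq>)"
      unfolding facets_def pf using F by auto
  qed
qed

lemma vertices_face_poset:
  fixes P :: "'a::euclidean_space set"
  assumes P: "polytope P"
  shows "vertices (face_poset P) (\<subseteq>) = {{v} | v. v extreme_point_of P}"
proof (intro set_eqI iffI)
  fix V assume "V \<in> vertices (face_poset P) (\<subseteq>)"
  then have V: "V face_of P" "V \<noteq> {}"
    and mn: "\<And>G. G face_of P \<Longrightarrow> G \<noteq> {} \<Longrightarrow> G \<subseteq> V \<Longrightarrow> G = V"
    by (auto simp: vertices_def face_poset_def)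
  have "polytope V" using face_of_polytope_polytope[OF P V(1)] .
  then obtain v where "v extreme_point_of V"
    using extreme_point_exists_convex V(2) polytope_imp_compact polytope_imp_convex by blast
  then have v: "v extreme_point_of P" "v \<in> V"
    using extreme_point_of_face[OF V(1)] by auto
  then have "{v} = V"
    using mn[of "{v}"] by (simp add: face_of_singleton)
  with v show "V \<in> {{v} | v. v extreme_point_of P}" by blast
next
  fix V assume "V \<in> {{v} | v. v extreme_point_of P}"
  then show "V \<in> vertices (face_poset P) (\<subseteq>)"
    by (auto simp: vertices_def face_poset_def face_of_singleton[symmetric])
qed

lemma separated_face_poset:
  fixes P :: "'a::euclidean_space set"
  assumes "polytope P"
  shows "separated (face_poset P) (\<subseteq>) F G \<longleftrightarrow>
    \<not> (\<exists>v. v extreme_point_of P \<and> v \<in> F \<and> v \<in> G)"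
  unfolding separated_def vertices_face_poset[OF assms] by auto

lemma proper_colouring_iso:
  assumes \<phi>: "bij_betw \<phi> L L'"
    and ord: "\<And>F G. F \<in> L \<Longrightarrow> G \<in> L \<Longrightarrow> le F G \<longleftrightarrow> le' (\<phi> F) (\<phi> G)"
    and f: "proper_colouring L' le' m f"
  shows "proper_colouring L le m (f \<circ> \<phi>)"
proof -
  have L': "L' = \<phi> ` L" and inj: "\<And>F G. F \<in> L \<Longrightarrow> G \<in> L \<Longrightarrow> \<phi> F = \<phi> G \<longleftrightarrow> F = G"
    using \<phi> by (auto simp: bij_betw_def inj_on_def)
  have pf: "F \<in> L \<Longrightarrow> \<phi> F \<in> proper_faces L' le' \<longleftrightarrow> F \<in> proper_faces L le" for F
    unfolding proper_faces_def L' using ord by auto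
  have pf': "proper_faces L' le' \<subseteq> \<phi> ` L" "proper_faces L le \<subseteq> L"
    unfolding proper_faces_def L' by auto
  have fc: "F \<in> facets L le \<Longrightarrow> F \<in> L \<and> \<phi> F \<in> facets L' le'" for F
    unfolding facets_def using pf pf' ord inj by (smt (verit, best) imageE mem_Collect_eq subsetD)
  have vt: "V \<in> vertices L le \<Longrightarrow> V \<in> L \<and> \<phi> V \<in> vertices L' le'" for V
    unfolding vertices_def L' using ord inj by auto
  have sp: "separated L' le' (\<phi> F) (\<phi> G) \<Longrightarrow> F \<in> L \<Longrightarrow> G \<in> L \<Longrightarrow> separated L le F G" for F G
    unfolding separated_def using vt ord by blast
  show ?thesis
    using f fc sp inj unfolding proper_colouring_def comp_def by meson
qed

lemma chromatic_number_iso: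
  assumes \<phi>: "bij_betw \<phi> L L'"
    and ord: "\<And>F G. F \<in> L \<Longrightarrow> G \<in> L \<Longrightarrow> le F G \<longleftrightarrow> le' (\<phi> F) (\<phi> G)"
  shows "chromatic_number L le = chromatic_number L' le'"
proof -
  have inv: "bij_betw (inv_into L \<phi>) L' L"
    using bij_betw_inv_into[OF \<phi>] .
  have "le' F G \<longleftrightarrow> le (inv_into L \<phi> F) (inv_into L \<phi> G)" if "F \<in> L'" "G \<in> L'" for F G
    using ord[of "inv_into L \<phi> F" "inv_into L \<phi> G"] that inv
    by (simp add: bij_betw_apply bij_betw_inv_into_right[OF \<phi>])
  then have "(\<exists>f. proper_colouring L le m f) \<longleftrightarrow> (\<exists>f. proper_colouring L' le' m f)" for m
    using proper_colouring_iso[OF \<phi>, of le le' m] proper_colouring_iso[OF inv, of le' le m] ord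
    by blast
  then show ?thesis by (simp add: chromatic_number_def)
qed

text \<open>
  Hence, for every convex polytope realising the associahedron, the number defined above is its
  chromatic number in the geometric sense.
\<close>

lemma associahedron_chromatic_number_realisation:
  fixes P :: "'a::euclidean_space set"
  assumes P: "polytope P"
    and \<phi>: "bij_betw \<phi> (face_poset P) (nested_set_complex n (path_building_set n))"
    and ord: "\<And>F G. F \<in> face_poset P \<Longrightarrow> G \<in> face_poset P \<Longrightarrow> F \<subseteq> G \<longleftrightarrow> \<phi> F \<supseteq> \<phi> G"
  shows "associahedron_chromatic_number n =
    (LEAST m. \<exists>f. (\<forall>F. F facet_of P \<longrightarrow> f F \<in> {1..m}) \<and>
      (\<forall>F G. F facet_of P \<and> G facet_of P \<and> F \<noteq> G \<and> f F = f G \<longrightarrow>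
        \<not> (\<exists>v. v extreme_point_of P \<and> v \<in> F \<and> v \<in> G)))"
proof -
  have "associahedron_chromatic_number n = chromatic_number (face_poset P) (\<subseteq>)"
    unfolding associahedron_chromatic_number_def nestohedron_chromatic_number_def
    using chromatic_number_iso[OF \<phi>, of "(\<subseteq>)" "(\<supseteq>)"] ord by simp
  then show ?thesis
    unfolding chromatic_number_def proper_colouring_def facets_face_poset[OF P]
      separated_face_poset[OF P]
    by (simp add: imp_conjL)
qed

end

theory Submission
  imports Defs "HOL-Analysis.Harmonic_Numbers" "HOL-Real_Asymp.Real_Asymp"
begin

text \<open>
  Two facets of the associahedron are separated exactly when the corresponding intervals of the
  path are incomparable and their union is again an interval. Attach to the interval
  \<open>{a..<a + d}\<close> the diagonal from \<open>a\<close> to \<open>a + d + 1\<close> of the polygon with vertices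
  \<open>0, \<dots>, n + 2\<close>; then separated facets are crossing diagonals
  (\<open>separated_associahedron_iff\<close>), and a proper colouring is a partition of the diagonals into
  families that cross pairwise.

  Upper bound. Consecutive translates of one diagonal cross as long as there are at most \<open>d + 1\<close>
  of them. The \<open>n + 2 - d\<close> intervals with \<open>d\<close> elements thus need at most
  \<open>(n + 2) div (d + 1)\<close> colours (\<open>block_colouring\<close>), and the sum over \<open>d\<close> is at most
  \<open>(n + 2) * (harm (n + 1) - 1)\<close>.

  Lower bound. Give the interval the weight \<open>1 / (d + 1)\<close>. A crossing family that contains it has
  at most \<open>d + 1\<close> members (\<open>card_crossing_family_le\<close>), because only \<open>d\<close> vertices lie strictly
  between the ends of its diagonal and each other member ends in one of them. So in a family of
  \<open>k\<close> members every weight is at most \<open>1 / k\<close>, the family has total weight at most \<open>1\<close>, and the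
  number of colours is at least the total weight of all intervals, which is
  \<open>(n + 3) * (harm (n + 1) - 1) - n\<close>.

  Since \<open>harm n\<close> differs from \<open>ln n\<close> by a bounded amount, both bounds are asymptotic to
  \<open>n * ln n\<close>.
\<close>

section \<open>Facets of a nestohedron and their separation\<close>

lemma nested_mono:
  assumes "nested B N" "M \<subseteq> N"
  shows "nested B M"
proof -
  have "antichain_in N A" if "antichain_in M A" for A
    using that assms(2) by (auto simp: antichain_in_def)
  then show ?thesis using assms by (auto simp: nested_def)
qed

lemma nested_pair_iff:
  assumes "X \<in> B" "Y \<in> B" "X \<noteq> Y"
  shows "nested B {X, Y} \<longleftrightarrow> X \<subseteq> Y \<or> Y \<subseteq> X \<or> X \<union> Y \<notin> B"
proof -
  have "antichain_in {X, Y} A \<longleftrightarrow> A = {X, Y} \<and> \<not> X \<subseteq> Y \<and> \<not> Y \<subseteq> X" for A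
  proof
    assume A: "antichain_in {X, Y} A"
    then have "A \<subseteq> {X, Y}" "card {X, Y} \<le> card A"
      using assms(3) by (auto simp: antichain_in_def)
    then have "A = {X, Y}" by (intro card_seteq) auto
    then show "A = {X, Y} \<and> \<not> X \<subseteq> Y \<and> \<not> Y \<subseteq> X"
      using A assms(3) by (auto simp: antichain_in_def)
  qed (use assms(3) in \<open>auto simp: antichain_in_def\<close>)
  then show ?thesis using assms by (auto simp: nested_def)
qed

lemma nested_singleton:
  assumes "X \<in> B"
  shows "nested B {X}"
proof -
  have "\<not> antichain_in {X} A" for A
    using card_mono[of "{X}" A] by (auto simp: antichain_in_def)
  then show ?thesis using assms by (simp add: nested_def)
qed

lemma facets_nested_set_complex:
  "facets (nested_set_complex n B) (\<supseteq>) = {{X} | X. X \<in> B \<and> X \<noteq> {0..n}}"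
proof -
  let ?L = "nested_set_complex n B"
  have sing: "{X} \<in> ?L \<longleftrightarrow> X \<in> B \<and> X \<noteq> {0..n}" for X
    using nested_singleton by (auto simp: nested_set_complex_def nested_def)
  have sub: "M \<in> ?L" if "N \<in> ?L" "M \<subseteq> N" for M N
    using that nested_mono by (auto simp: nested_set_complex_def)
  have pf: "proper_faces ?L (\<supseteq>) = ?L - {{}}"
    using sub[of _ "{}"] by (auto simp: proper_faces_def)
  show ?thesis
  proof (intro set_eqI iffI)
    fix F assume F: "F \<in> facets ?L (\<supseteq>)"
    then obtain X where "X \<in> F" "F \<in> ?L" unfolding facets_def pf by auto
    moreover from this have "{X} \<in> ?L" using sub[of F "{X}"] by simp
    ultimately have "F = {X}" using F unfolding facets_def pf by auto
    then show "F \<in> {{X} | X. X \<in> B \<and> X \<noteq> {0..n}}"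
      using \<open>{X} \<in> ?L\<close> sing by blast
  next
    fix F assume "F \<in> {{X} | X. X \<in> B \<and> X \<noteq> {0..n}}"
    then show "F \<in> facets ?L (\<supseteq>)"
      using sing unfolding facets_def pf by auto
  qed
qed

text \<open>
  Vertices are the maximal nested sets in the complex. As the complex is finite, every nested set
  in it extends to a maximal one, so two facets share a vertex as soon as their two elements form a
  nested set.
\<close>

lemma separated_nested_set_complex_iff:
  assumes "finite B" "X \<in> B" "Y \<in> B" "X \<noteq> {0..n}" "Y \<noteq> {0..n}" "X \<noteq> Y"
  shows "separated (nested_set_complex n B) (\<supseteq>) {X} {Y} \<longleftrightarrow>
    \<not> X \<subseteq> Y \<and> \<not> Y \<subseteq> X \<and> X \<union> Y \<in> B"
proof -
  let ?L = "nested_set_complex n B"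
  have "(\<exists>V\<in>vertices ?L (\<supseteq>). {X} \<subseteq> V \<and> {Y} \<subseteq> V) \<longleftrightarrow> nested B {X, Y}"
  proof
    assume "\<exists>V\<in>vertices ?L (\<supseteq>). {X} \<subseteq> V \<and> {Y} \<subseteq> V"
    then show "nested B {X, Y}"
      unfolding vertices_def nested_set_complex_def by (blast intro: nested_mono)
  next
    assume "nested B {X, Y}"
    then have "{X, Y} \<in> ?L" using assms by (auto simp: nested_set_complex_def)
    moreover have "finite ?L"
      by (rule finite_subset[of _ "Pow B"])
        (use assms(1) in \<open>auto simp: nested_set_complex_def nested_def\<close>)
    ultimately have "\<exists>V\<in>?L. {X, Y} \<subseteq> V \<and> (\<forall>N\<in>?L. V \<subseteq> N \<longrightarrow> V = N)"
      by (intro finite_has_maximal2)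
    then obtain V where V: "V \<in> ?L" "{X, Y} \<subseteq> V \<and> (\<forall>N\<in>?L. V \<subseteq> N \<longrightarrow> V = N)"
      by (rule bexE)
    then have "V \<in> vertices ?L (\<supseteq>)"
      unfolding vertices_def by blast
    then show "\<exists>V\<in>vertices ?L (\<supseteq>). {X} \<subseteq> V \<and> {Y} \<subseteq> V"
      using V(2) by (intro bexI[of _ V]) simp_all
  qed
  then have "separated ?L (\<supseteq>) {X} {Y} \<longleftrightarrow> \<not> nested B {X, Y}"
    by (simp only: separated_def)
  then show ?thesis
    using nested_pair_iff[OF assms(2,3,6)] by blast
qed

section \<open>Colourings of the facets of the associahedron\<close>

text \<open>
  The pair \<open>(d, a)\<close> stands for the interval \<open>{a..<a + d}\<close> of \<open>d\<close> vertices; grouping the intervals by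
  their length makes both bounds below sums over \<open>d\<close>.
\<close>

definition interval_codes :: "nat \<Rightarrow> (nat \<times> nat) set" where
  "interval_codes n = (SIGMA d:{1..n}. {0..n + 1 - d})"

definition interval_of :: "nat \<times> nat \<Rightarrow> nat set" where
  "interval_of = (\<lambda>(d, a). {a..<a + d})"

text \<open>
  For the diagonals joining \<open>a\<close> to \<open>a + d + 1\<close> in the polygon with vertices \<open>0, \<dots>, n + 2\<close>,
  this is \<open>a < a' < a + d + 1 < a' + d' + 1\<close>: they cross, and the first one starts at the smaller
  vertex.
\<close>

definition crosses :: "nat \<times> nat \<Rightarrow> nat \<times> nat \<Rightarrow> bool" where
  "crosses = (\<lambda>(d, a) (d', a'). a < a' \<and> a' \<le> a + d \<and> a + d < a' + d')"

lemma finite_interval_codes: "finite (interval_codes n)"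
  by (simp add: interval_codes_def)

lemma inj_on_interval_of: "inj_on interval_of (interval_codes n)"
proof (rule inj_onI)
  fix p q assume p: "p \<in> interval_codes n" and q: "q \<in> interval_codes n"
    and eq: "interval_of p = interval_of q"
  obtain d a e b where pq: "p = (d, a)" "q = (e, b)" by (cases p, cases q)
  have "0 < d" "0 < e" using p q by (auto simp: pq interval_codes_def)
  then show "p = q"
    using atLeastLessThan_eq_iff[of a "a + d" b "b + e"] eq by (auto simp: pq interval_of_def)
qed

lemma interval_of_codes:
  "interval_of ` interval_codes n = path_building_set n - {{0..n}}"
proof (intro set_eqI iffI)
  fix X assume "X \<in> interval_of ` interval_codes n"
  then obtain d a where X: "X = {a..<a + d}" and da: "1 \<le> d" "d \<le> n" "a + d \<le> n + 1"
    by (auto simp: interval_codes_def interval_of_def)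
  have "{a..<a + d} = {a..a + d - 1}" "a \<le> a + d - 1" "a + d - 1 \<le> n"
    using da by auto
  then have "X \<in> path_building_set n"
    unfolding X path_building_set_def by blast
  moreover have "card X \<noteq> card {0..n}" using X da by simp
  ultimately show "X \<in> path_building_set n - {{0..n}}" by blast
next
  fix X assume *: "X \<in> path_building_set n - {{0..n}}"
  then obtain a b where X: "X = {a..b}" and ab: "a \<le> b" "b \<le> n"
    by (auto simp: path_building_set_def)
  have "a \<noteq> 0 \<or> b \<noteq> n" using * X by auto
  with ab(1,2) have "(b + 1 - a, a) \<in> interval_codes n" by (auto simp: interval_codes_def)
  moreover have "interval_of (b + 1 - a, a) = X"
    unfolding X using ab(1) by (auto simp: interval_of_def)
  ultimately show "X \<in> interval_of ` interval_codes n" by (metis imageI)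
qed

lemma facets_associahedron:
  "facets (nested_set_complex n (path_building_set n)) (\<supseteq>)
    = (\<lambda>p. {interval_of p}) ` interval_codes n"
proof -
  have "facets (nested_set_complex n (path_building_set n)) (\<supseteq>)
      = (\<lambda>X. {X}) ` (path_building_set n - {{0..n}})"
    unfolding facets_nested_set_complex by blast
  then show ?thesis by (simp only: interval_of_codes[symmetric] image_image)
qed

lemma interval_of_mem_path_building_set:
  assumes "p \<in> interval_codes n"
  shows "interval_of p \<in> path_building_set n" "interval_of p \<noteq> {0..n}"
  using imageI[OF assms, of interval_of] unfolding interval_of_codes by simp_all

lemma union_in_path_building_set_iff:
  assumes d: "0 < d" "a + d \<le> n + 1" and e: "0 < e" "b + e \<le> n + 1"
  shows "{a..<a + d} \<union> {b..<b + e} \<in> path_building_set n \<longleftrightarrow> b \<le> a + d \<and> a \<le> b + e"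
proof
  assume "{a..<a + d} \<union> {b..<b + e} \<in> path_building_set n"
  then obtain u v where "{a..<a + d} \<union> {b..<b + e} = {u..v}"
    unfolding path_building_set_def by auto
  then have mem: "x \<in> {u..v} \<longleftrightarrow> x \<in> {a..<a + d} \<or> x \<in> {b..<b + e}" for x
    by (metis Un_iff)
  have ab: "u \<le> a" "a \<le> v" "u \<le> b" "b \<le> v"
    using mem[of a] mem[of b] d e by simp_all
  \<comment> \<open>If there were a gap, the point just after the left interval would lie in neither interval,
    although it lies between \<open>u\<close> and \<open>v\<close>.\<close>
  show "b \<le> a + d \<and> a \<le> b + e"
    using mem[of "a + d"] mem[of "b + e"] ab by (simp, linarith)
next
  assume "b \<le> a + d \<and> a \<le> b + e"
  then have "{a..<a + d} \<union> {b..<b + e} = {min a b..max (a + d) (b + e) - 1}"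
    using d e by auto
  moreover have "min a b \<le> max (a + d) (b + e) - 1" "max (a + d) (b + e) - 1 \<le> n"
    using d e by auto
  ultimately show "{a..<a + d} \<union> {b..<b + e} \<in> path_building_set n"
    unfolding path_building_set_def by blast
qed

lemma separated_associahedron_iff:
  assumes p: "p \<in> interval_codes n" and q: "q \<in> interval_codes n" and "p \<noteq> q"
  shows "separated (nested_set_complex n (path_building_set n)) (\<supseteq>) {interval_of p} {interval_of q}
    \<longleftrightarrow> crosses p q \<or> crosses q p"
proof -
  obtain d a e b where pq: "p = (d, a)" "q = (e, b)" by (cases p, cases q)
  have d: "0 < d" "a + d \<le> n + 1" and e: "0 < e" "b + e \<le> n + 1"
    using p q by (auto simp: pq interval_codes_def)
  have XY: "interval_of p = {a..<a + d}" "interval_of q = {b..<b + e}"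
    by (simp_all add: pq interval_of_def)
  have finite: "finite (path_building_set n)"
    by (rule finite_subset[of _ "Pow {0..n}"]) (auto simp: path_building_set_def)
  have "interval_of p \<noteq> interval_of q"
    using inj_onD[OF inj_on_interval_of _ p q] \<open>p \<noteq> q\<close> by blast
  then have "separated (nested_set_complex n (path_building_set n)) (\<supseteq>)
        {interval_of p} {interval_of q}
      \<longleftrightarrow> \<not> interval_of p \<subseteq> interval_of q \<and> \<not> interval_of q \<subseteq> interval_of p
        \<and> interval_of p \<union> interval_of q \<in> path_building_set n"
    by (intro separated_nested_set_complex_iff finite interval_of_mem_path_building_set p q)
  also have "\<dots> \<longleftrightarrow> \<not> (b \<le> a \<and> a + d \<le> b + e) \<and> \<not> (a \<le> b \<and> b + e \<le> a + d)
      \<and> b \<le> a + d \<and> a \<le> b + e"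
    using d e by (simp add: XY union_in_path_building_set_iff)
  also have "\<dots> \<longleftrightarrow> crosses p q \<or> crosses q p"
    using d e by (auto simp: pq crosses_def)
  finally show ?thesis .
qed

text \<open>
  The natural colours of the block colouring below are pairs, so the colours here range over an
  arbitrary finite set.
\<close>

lemma proper_colouring_associahedronI:
  fixes g :: "nat \<times> nat \<Rightarrow> 'c"
  assumes "finite C" "g ` interval_codes n \<subseteq> C"
    and g: "\<And>p q. p \<in> interval_codes n \<Longrightarrow> q \<in> interval_codes n \<Longrightarrow> p \<noteq> q \<Longrightarrow> g p = g q
      \<Longrightarrow> crosses p q \<or> crosses q p"
  shows "\<exists>f. proper_colouring (nested_set_complex n (path_building_set n)) (\<supseteq>) (card C) f"
proof -
  obtain h where h: "bij_betw h C {1..card C}"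
    using ex_bij_betw_nat_finite_1[OF assms(1)] bij_betw_inv_into by blast
  define f where "f F = h (g (inv_into (interval_codes n) interval_of (the_elem F)))" for F
  have f: "f {interval_of p} = h (g p)" if "p \<in> interval_codes n" for p
    using inv_into_f_f[OF inj_on_interval_of that] by (simp add: f_def)
  have hC: "h (g p) \<in> {1..card C}" if "p \<in> interval_codes n" for p
    using bij_betwE[OF h] that assms(2) by blast
  have hg: "g p = g q" if "p \<in> interval_codes n" "q \<in> interval_codes n" "h (g p) = h (g q)" for p q
    using bij_betw_imp_inj_on[OF h] that assms(2) by (auto dest!: inj_onD)
  have "proper_colouring (nested_set_complex n (path_building_set n)) (\<supseteq>) (card C) f"
    unfolding proper_colouring_def facets_associahedron
  proof (intro conjI ballI impI)
    fix F assume "F \<in> (\<lambda>p. {interval_of p}) ` interval_codes n"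
    then show "f F \<in> {1..card C}" using f hC by auto
  next
    fix F G
    assume "F \<in> (\<lambda>p. {interval_of p}) ` interval_codes n"
      "G \<in> (\<lambda>p. {interval_of p}) ` interval_codes n" and FG: "F \<noteq> G \<and> f F = f G"
    then obtain p q where pq: "p \<in> interval_codes n" "q \<in> interval_codes n"
      "F = {interval_of p}" "G = {interval_of q}" by auto
    then have "p \<noteq> q" "g p = g q" using FG hg f by auto
    then show "separated (nested_set_complex n (path_building_set n)) (\<supseteq>) F G"
      using separated_associahedron_iff g pq by blast
  qed
  then show ?thesis by blast
qed

section \<open>The upper bound\<close>

text \<open>
  Intervals of \<open>d\<close> vertices whose left ends lie within distance \<open>d\<close> of one another cross pairwise.
  So one colour serves a block of \<open>d + 1\<close> consecutive translates.
\<close>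

lemma block_colouring:
  "\<exists>f. proper_colouring (nested_set_complex n (path_building_set n)) (\<supseteq>)
    (\<Sum>d=1..n. (n + 2) div (d + 1)) f"
proof -
  define C where "C = (SIGMA d:{1..n}. {0..(n + 1 - d) div (d + 1)})"
  define g where "g = (\<lambda>(d, a). (d, a div (d + 1)) :: nat \<times> nat)"
  have "\<exists>f. proper_colouring (nested_set_complex n (path_building_set n)) (\<supseteq>) (card C) f"
  proof (rule proper_colouring_associahedronI[of C g])
    show "finite C" by (simp add: C_def)
    show "g ` interval_codes n \<subseteq> C"
      by (auto simp: g_def C_def interval_codes_def intro!: div_le_mono)
    fix p q assume p: "p \<in> interval_codes n" and q: "q \<in> interval_codes n"
      and "p \<noteq> q" "g p = g q"
    then obtain d a b where pq: "p = (d, a)" "q = (d, b)"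
      and same: "a div (d + 1) = b div (d + 1)" and "a \<noteq> b"
      by (cases p; cases q) (auto simp: g_def)
    have "a mod (d + 1) < d + 1" "b mod (d + 1) < d + 1" by simp_all
    then have "a < b + (d + 1)" "b < a + (d + 1)"
      using div_mult_mod_eq[of a "d + 1"] div_mult_mod_eq[of b "d + 1"] unfolding same
      by linarith+
    then show "crosses p q \<or> crosses q p"
      using \<open>a \<noteq> b\<close> by (auto simp: pq crosses_def)
  qed
  moreover have "card C = (\<Sum>d=1..n. (n + 2) div (d + 1))"
  proof -
    \<comment> \<open>Blocks are numbered from \<open>0\<close>, whence the \<open>+ 1\<close>, which also turns \<open>n + 1 - d\<close> into
      \<open>n + 2\<close>.\<close>
    have "(n + 2) div (d + 1) = (n + 1 - d) div (d + 1) + 1" if "d \<in> {1..n}" for d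
      using that div_add_self2[of "d + 1" "n + 1 - d"] by simp
    then show ?thesis by (simp add: C_def card_SigmaI)
  qed
  ultimately show ?thesis by simp
qed

lemma sum_inverse_eq_harm: "(\<Sum>d=1..n. 1 / real (d + 1)) = harm (n + 1) - 1"
proof (induction n)
  case (Suc n)
  have "harm (Suc n + 1) = harm (n + 1) + 1 / real (Suc n + 1)"
    using harm_Suc[of "n + 1"] by (simp add: inverse_eq_divide)
  then show ?case using Suc by simp
qed (simp add: harm_expand)

lemma associahedron_chromatic_number_le:
  "real (associahedron_chromatic_number n) \<le> (real n + 2) * (harm (n + 1) - 1)"
proof -
  have "associahedron_chromatic_number n \<le> (\<Sum>d=1..n. (n + 2) div (d + 1))"
    unfolding associahedron_chromatic_number_def nestohedron_chromatic_number_def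
      chromatic_number_def
    by (rule Least_le) (rule block_colouring)
  then have "real (associahedron_chromatic_number n) \<le> (\<Sum>d=1..n. real ((n + 2) div (d + 1)))"
    by (metis of_nat_le_iff of_nat_sum)
  also have "\<dots> \<le> (\<Sum>d=1..n. (real n + 2) * (1 / real (d + 1)))"
  proof (rule sum_mono)
    fix d
    show "real ((n + 2) div (d + 1)) \<le> (real n + 2) * (1 / real (d + 1))"
      using of_nat_div_le_of_nat[of "n + 2" "d + 1", where ?'a = real] by (simp add: add.commute)
  qed
  also have "\<dots> = (real n + 2) * (harm (n + 1) - 1)"
    by (simp only: sum_distrib_left[symmetric] sum_inverse_eq_harm)
  finally show ?thesis .
qed

section \<open>The lower bound\<close>

text \<open>
  Diagonals that cross pairwise have distinct ends, and each other diagonal of the family has one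
  of its ends strictly between the ends of the given one. Together with the left end \<open>a\<close> itself
  these are distinct elements of \<open>{a..a + d}\<close>.
\<close>

lemma card_crossing_family_le:
  assumes K: "\<And>p q. p \<in> K \<Longrightarrow> q \<in> K \<Longrightarrow> p \<noteq> q \<Longrightarrow> crosses p q \<or> crosses q p"
    and da: "(d, a) \<in> K"
  shows "card K \<le> d + 1"
proof -
  define h where "h = (\<lambda>(e, b). if a \<le> b then b else b + e + 1 :: nat)"
  have "inj_on h K"
  proof (rule inj_onI, rule ccontr)
    fix p q assume pq: "p \<in> K" "q \<in> K" "h p = h q" "p \<noteq> q"
    then show False using K[OF pq(1,2,4)]
      by (auto simp: h_def crosses_def split: if_splits prod.splits)
  qed
  moreover have "h ` K \<subseteq> {a..a + d}"
  proof (rule image_subsetI)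
    fix p assume "p \<in> K"
    then show "h p \<in> {a..a + d}"
      using K[OF \<open>p \<in> K\<close> da]
      by (cases "p = (d, a)") (auto simp: h_def crosses_def split: if_splits prod.splits)
  qed
  ultimately have "card K \<le> card {a..a + d}"
    by (meson card_inj_on_le finite_atLeastAtMost)
  then show ?thesis by simp
qed

text \<open>
  No weight in the family exceeds the reciprocal of its size, by the preceding bound applied to
  each member in turn.
\<close>

lemma crossing_family_weight_le_1:
  assumes K: "\<And>p q. p \<in> K \<Longrightarrow> q \<in> K \<Longrightarrow> p \<noteq> q \<Longrightarrow> crosses p q \<or> crosses q p"
  shows "(\<Sum>(d, a)\<in>K. 1 / real (d + 1)) \<le> 1"
proof (cases "finite K \<and> K \<noteq> {}")
  case True
  have "(\<Sum>(d, a)\<in>K. 1 / real (d + 1)) \<le> (\<Sum>p\<in>K. 1 / real (card K))"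
  proof (rule sum_mono)
    fix p assume p: "p \<in> K"
    obtain d a where da: "p = (d, a)" by fastforce
    have "card K \<le> d + 1" using card_crossing_family_le[of K d a] K p da by blast
    moreover have "0 < card K" using True by (simp add: card_gt_0_iff)
    ultimately show "(case p of (d, a) \<Rightarrow> 1 / real (d + 1)) \<le> 1 / real (card K)"
      by (simp add: da frac_le)
  qed
  also have "\<dots> = 1" using True by simp
  finally show ?thesis .
next
  \<comment> \<open>Crossing families are finite by the same injection; the sum over an infinite set is \<open>0\<close> by
    convention, which suffices.\<close>
  case False
  then show ?thesis by auto
qed

lemma sum_interval_weights:
  "(\<Sum>(d, a)\<in>interval_codes n. 1 / real (d + 1)) = (real n + 3) * (harm (n + 1) - 1) - real n"
proof -
  have "(\<Sum>(d, a)\<in>interval_codes n. 1 / real (d + 1))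
      = (\<Sum>d=1..n. \<Sum>a=0..n + 1 - d. 1 / real (d + 1))"
    unfolding interval_codes_def by (rule sum.Sigma[symmetric]) simp_all
  also have "\<dots> = (\<Sum>d=1..n. (real n + 3) * (1 / real (d + 1)) - 1)"
    by (intro sum.cong) (auto simp: of_nat_diff field_simps)
  also have "\<dots> = (real n + 3) * (harm (n + 1) - 1) - real n"
    by (simp only: sum_subtractf sum_distrib_left[symmetric] sum_inverse_eq_harm) simp
  finally show ?thesis .
qed

lemma proper_colouring_associahedron_ge:
  assumes f: "proper_colouring (nested_set_complex n (path_building_set n)) (\<supseteq>) m f"
  shows "(real n + 3) * (harm (n + 1) - 1) - real n \<le> real m"
proof -
  let ?w = "\<lambda>(d, a). 1 / real (d + 1)"
  define c where "c p = f {interval_of p}" for p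
  have c: "c ` interval_codes n \<subseteq> {1..m}"
    using f by (auto simp: proper_colouring_def facets_associahedron c_def)
  have "(real n + 3) * (harm (n + 1) - 1) - real n = sum ?w (interval_codes n)"
    by (rule sum_interval_weights[symmetric])
  also have "\<dots> = (\<Sum>i=1..m. sum ?w {p \<in> interval_codes n. c p = i})"
    by (rule sum.group[symmetric]) (use c finite_interval_codes in auto)
  also have "\<dots> \<le> (\<Sum>i=1..m. 1)"
  proof (rule sum_mono, rule crossing_family_weight_le_1)
    fix i p q
    assume "p \<in> {p \<in> interval_codes n. c p = i}" "q \<in> {p \<in> interval_codes n. c p = i}"
      and "p \<noteq> q"
    then have pq: "p \<in> interval_codes n" "q \<in> interval_codes n" "c p = c q" by auto
    then have "interval_of p \<noteq> interval_of q"
      using \<open>p \<noteq> q\<close> inj_on_interval_of by (auto dest: inj_onD)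
    then have "separated (nested_set_complex n (path_building_set n)) (\<supseteq>)
        {interval_of p} {interval_of q}"
      using f pq by (auto simp: proper_colouring_def facets_associahedron c_def)
    then show "crosses p q \<or> crosses q p"
      using separated_associahedron_iff[OF pq(1,2) \<open>p \<noteq> q\<close>] by simp
  qed
  finally show ?thesis by simp
qed

lemma associahedron_chromatic_number_ge:
  "(real n + 3) * (harm (n + 1) - 1) - real n \<le> real (associahedron_chromatic_number n)"
proof -
  let ?P = "\<lambda>m. \<exists>f. proper_colouring (nested_set_complex n (path_building_set n)) (\<supseteq>) m f"
  have "?P (associahedron_chromatic_number n)"
    unfolding associahedron_chromatic_number_def nestohedron_chromatic_number_def
      chromatic_number_def
    by (rule LeastI[of ?P]) (rule block_colouring)
  then show ?thesis using proper_colouring_associahedron_ge by blast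
qed

section \<open>The asymptotics\<close>

theorem theorem4p9:
  shows "(\<lambda>n. real (associahedron_chromatic_number n) / (real n * ln (real n))) \<longlonglongrightarrow> 1"
proof (rule tendsto_sandwich)
  let ?lo = "\<lambda>n::nat. ((real n + 3) * (ln (real n + 2) - 1) - real n) / (real n * ln (real n))"
  let ?hi = "\<lambda>n::nat. ((real n + 2) * ln (real n + 1)) / (real n * ln (real n))"
  show "\<forall>\<^sub>F n in sequentially.
      ?lo n \<le> real (associahedron_chromatic_number n) / (real n * ln (real n))"
    using eventually_ge_at_top[of 2]
  proof eventually_elim
    case (elim n)
    have "ln (real n + 2) \<le> harm (n + 1)" using ln_le_harm[of "n + 1"] by (simp add: add.commute)
    then have "(real n + 3) * (ln (real n + 2) - 1) \<le> (real n + 3) * (harm (n + 1) - 1)"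
      by (intro mult_left_mono) auto
    then have "(real n + 3) * (ln (real n + 2) - 1) - real n
        \<le> real (associahedron_chromatic_number n)"
      using associahedron_chromatic_number_ge[of n] by linarith
    then show ?case using elim by (intro divide_right_mono) auto
  qed
  show "\<forall>\<^sub>F n in sequentially.
      real (associahedron_chromatic_number n) / (real n * ln (real n)) \<le> ?hi n"
    using eventually_ge_at_top[of 2]
  proof eventually_elim
    case (elim n)
    have "harm (n + 1) - 1 \<le> ln (real n + 1)"
      using euler_mascheroni_sequence_decreasing[of 1 "n + 1"] by (simp add: harm_expand add.commute)
    then have "(real n + 2) * (harm (n + 1) - 1) \<le> (real n + 2) * ln (real n + 1)"
      by (intro mult_left_mono) auto
    then have "real (associahedron_chromatic_number n) \<le> (real n + 2) * ln (real n + 1)"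
      using associahedron_chromatic_number_le[of n] by linarith
    then show ?case using elim by (intro divide_right_mono) auto
  qed
  show "?lo \<longlonglongrightarrow> 1" by real_asymp
  show "?hi \<longlonglongrightarrow> 1" by real_asymp
qed

end
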